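(* Let $(a,x_1,x_2,x_3)\in\mathbb C^4$. Then the following are equivalent: (1) $(a,x_1,x_2,x_3)\in\mathbb H$; (2) $(x_1,x_2,x_3)\in\mathbb E$ and $|a|K_*(x_1,x_2,x_3)<1$; (3) $(x_1,x_2,x_3)\in\mathbb E$ and $|\psi_{z_1,z_2}(a,x_1,x_2,x_3)|<1$ for all $z_1,z_2\in\mathbb D$; (4) either $(a,x_1,x_2,x_3)\in\mathbb H_\mu$ or $(a,x_1,x_2,x_3)\in\{0\}\times\mathbb E$. Consequently, $\mathbb H=\mathbb H_\mu\cup(\{0\}\times\mathbb E)=\mathrm{int}(\mathbb H_\mu)\cup(\{0\}\times\mathbb E)$ and $\mathbb H_N\subset\mathbb H_\mu\subset\mathbb H$.
   Context: $\mathbb D$ is the open unit disc in $\mathbb C$, $\overline{\mathbb D}$ its closure; $\mathrm{int}(\cdot)$ is the interior in $\mathbb C^4$; $\|\cdot\|$ is the operator norm on $M_2(\mathbb C)$ induced by the Euclidean norm on $\mathbb C^2$. Let $E\subset M_2(\mathbb C)$ be the linear space of all upper triangular matrices. For $A\in M_2(\mathbb C)$, $$\mu_{\mathrm{hexa}}(A)=\frac{1}{\inf\{\|X\| : X\in E,\ \det(I-AX)=0\}},$$ with $\mu_{\mathrm{hexa}}(A)=0$ if $\det(I-AX)\ne0$ for all $X\in E$. $\pi:M_2(\mathbb C)\to\mathbb C^4$ is $\pi((a_{ij}))=(a_{21},a_{11},a_{22},\det(A))$; $\mathbb H_\mu=\{\pi(A): A\in M_2(\mathbb C),\ \mu_{\mathrm{hexa}}(A)<1\}$;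 $\mathbb H_N=\{\pi(A): A\in M_2(\mathbb C),\ \|A\|<1\}$. The tetrablock is $\mathbb E=\{(x_1,x_2,x_3)\in\mathbb C^3: 1-x_1z_1-x_2z_2+x_3z_1z_2\ne0 \text{ for all } z_1,z_2\in\overline{\mathbb D}\}$. For $(a,x_1,x_2,x_3)\in\mathbb C\times\mathbb E$ and $z_1,z_2\in\overline{\mathbb D}$, $\psi_{z_1,z_2}(a,x_1,x_2,x_3)=\dfrac{a\sqrt{(1-|z_1|^2)(1-|z_2|^2)}}{1-x_1z_1-x_2z_2+x_3z_1z_2}$. For $x=(x_1,x_2,x_3)\in\mathbb E$, $K_*(x)=\max_{z_1,z_2\in\overline{\mathbb D}}|\psi_{z_1,z_2}(1,x_1,x_2,x_3)|$. The hexablock is $\mathbb H=\{(a,x_1,x_2,x_3)\in\mathbb C\times\mathbb E:\ \sup_{z_1,z_2\in\mathbb D}|\psi_{z_1,z_2}(a,x_1,x_2,x_3)|<1\}$. *)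

theory Defs
  imports "HOL-Analysis.Analysis"
begin

definition opnorm :: "complex^2^2 \<Rightarrow> real" where
  "opnorm A = onorm (\<lambda>v. A *v v)"

definition upper_triangular2 :: "(complex^2^2) set" where
  "upper_triangular2 = {X. X $ 2 $ 1 = 0}"

text \<open>
  The infimum is over a set of positive reals bounded away from 0 (by 1 over the operator norm
  of A), so the division is harmless whenever the set is nonempty.
\<close>
definition mu_hexa :: "complex^2^2 \<Rightarrow> real" where
  "mu_hexa A =
     (if \<forall>X\<in>upper_triangular2. det (mat 1 - A ** X) \<noteq> 0 then 0
      else 1 / Inf {opnorm X | X. X \<in> upper_triangular2 \<and> det (mat 1 - A ** X) = 0})"

definition hexa_pi :: "complex^2^2 \<Rightarrow> complex \<times> complex \<times> complex \<times> complex" where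
  "hexa_pi A = (A $ 2 $ 1, A $ 1 $ 1, A $ 2 $ 2, det A)"

definition hexablock_mu :: "(complex \<times> complex \<times> complex \<times> complex) set" where
  "hexablock_mu = {hexa_pi A | A. mu_hexa A < 1}"

definition hexablock_norm :: "(complex \<times> complex \<times> complex \<times> complex) set" where
  "hexablock_norm = {hexa_pi A | A. opnorm A < 1}"

definition tetrablock :: "(complex \<times> complex \<times> complex) set" where
  "tetrablock = {(x1, x2, x3).
     \<forall>z1\<in>cball 0 1. \<forall>z2\<in>cball 0 1. 1 - x1 * z1 - x2 * z2 + x3 * z1 * z2 \<noteq> 0}"

text \<open>Only meaningful for (x1, x2, x3) in the tetrablock and z1, z2 in the closed unit disc.\<close>
definition hexa_psi ::
    "complex \<Rightarrow> complex \<Rightarrow> complex \<times> complex \<times> complex \<times> complex \<Rightarrow> complex" where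
  "hexa_psi z1 z2 = (\<lambda>(a, x1, x2, x3).
     a * complex_of_real (sqrt ((1 - (cmod z1)\<^sup>2) * (1 - (cmod z2)\<^sup>2)))
       / (1 - x1 * z1 - x2 * z2 + x3 * z1 * z2))"

text \<open>
  A maximum, written as a supremum; that it is attained on the tetrablock is the lemma
  \<open>K_star_attained\<close> below.
\<close>
definition K_star :: "complex \<times> complex \<times> complex \<Rightarrow> real" where
  "K_star = (\<lambda>(x1, x2, x3).
     SUP (z1, z2) \<in> cball 0 1 \<times> cball 0 1. cmod (hexa_psi z1 z2 (1, x1, x2, x3)))"

text \<open>
  The real supremum is over a bounded set, because (x1, x2, x3) is in the tetrablock
  (lemma \<open>hexa_psi_bdd_above\<close>).
\<close>
definition hexablock :: "(complex \<times> complex \<times> complex \<times> complex) set" where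
  "hexablock = {(a, x1, x2, x3). (x1, x2, x3) \<in> tetrablock \<and>
     (SUP (z1, z2) \<in> ball 0 1 \<times> ball 0 1. cmod (hexa_psi z1 z2 (a, x1, x2, x3))) < 1}"

lemma hexa_psi_attains_max:
  assumes "(x1, x2, x3) \<in> tetrablock"
  obtains w1 w2 where "w1 \<in> cball 0 1" "w2 \<in> cball 0 1"
    "\<And>z1 z2. z1 \<in> cball 0 1 \<Longrightarrow> z2 \<in> cball 0 1 \<Longrightarrow>
       cmod (hexa_psi z1 z2 (a, x1, x2, x3)) \<le> cmod (hexa_psi w1 w2 (a, x1, x2, x3))"
proof -
  let ?f = "\<lambda>p. cmod (hexa_psi (fst p) (snd p) (a, x1, x2, x3))"
  let ?B = "cball 0 1 \<times> cball 0 1 :: (complex \<times> complex) set"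
  have "continuous_on ?B ?f"
    using assms unfolding hexa_psi_def tetrablock_def
    by (auto intro!: continuous_intros)
  then obtain w where "w \<in> ?B" "\<forall>z\<in>?B. ?f z \<le> ?f w"
    using continuous_attains_sup[of ?B ?f] by (auto simp: compact_Times)
  then show ?thesis
    using that[of "fst w" "snd w"] by fastforce
qed

lemma hexa_psi_bdd_above:
  assumes "(x1, x2, x3) \<in> tetrablock"
  shows "bdd_above ((\<lambda>(z1, z2). cmod (hexa_psi z1 z2 (a, x1, x2, x3))) ` (ball 0 1 \<times> ball 0 1))"
proof -
  obtain w1 w2 where "\<And>z1 z2. z1 \<in> cball 0 1 \<Longrightarrow> z2 \<in> cball 0 1 \<Longrightarrow>
       cmod (hexa_psi z1 z2 (a, x1, x2, x3)) \<le> cmod (hexa_psi w1 w2 (a, x1, x2, x3))"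
    using hexa_psi_attains_max[OF assms] by blast
  then show ?thesis
    by (intro bdd_aboveI[of _ "cmod (hexa_psi w1 w2 (a, x1, x2, x3))"]) auto
qed

lemma K_star_attained:
  assumes "(x1, x2, x3) \<in> tetrablock"
  shows "\<exists>w1\<in>cball 0 1. \<exists>w2\<in>cball 0 1. K_star (x1, x2, x3) = cmod (hexa_psi w1 w2 (1, x1, x2, x3)) \<and>
     (\<forall>z1\<in>cball 0 1. \<forall>z2\<in>cball 0 1. cmod (hexa_psi z1 z2 (1, x1, x2, x3)) \<le> K_star (x1, x2, x3))"
proof -
  obtain w1 w2 where w: "w1 \<in> cball 0 1" "w2 \<in> cball 0 1"
    "\<And>z1 z2. z1 \<in> cball 0 1 \<Longrightarrow> z2 \<in> cball 0 1 \<Longrightarrow>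
       cmod (hexa_psi z1 z2 (1, x1, x2, x3)) \<le> cmod (hexa_psi w1 w2 (1, x1, x2, x3))"
    using hexa_psi_attains_max[OF assms] by blast
  have "K_star (x1, x2, x3) = cmod (hexa_psi w1 w2 (1, x1, x2, x3))"
    unfolding K_star_def prod.case
    by (rule cSup_eq_maximum) (use w in auto)
  then show ?thesis
    by (intro bexI[of _ w1] bexI[of _ w2] conjI ballI) (use w in auto)
qed

end

theory Submission
  imports Defs
begin

text \<open>
  Everything reduces to one condition on a point \<open>(a, x1, x2, x3)\<close>: the polynomial
  \<open>1 - x1 z1 - x2 z2 + x3 z1 z2 - a w\<close> has no zero \<open>(z1, z2, w)\<close> for which the upper triangular
  matrix with diagonal \<open>(z1, z2)\<close> and corner \<open>w\<close> is a contraction.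

  Such a matrix is a contraction exactly when \<open>z1\<close>, \<open>z2\<close> lie in the closed disc and
  \<open>|w|\<^sup>2 \<le> (1 - |z1|\<^sup>2) (1 - |z2|\<^sup>2)\<close> (\<open>opnorm_le_1_iff\<close>). For fixed \<open>z1\<close>, \<open>z2\<close> the term \<open>a w\<close>
  therefore fills a closed disc around 0 whose radius is the modulus of the numerator of \<open>\<psi>\<close>, so
  the polynomial avoids 0 exactly when its part free of \<open>w\<close> does not vanish and \<open>|\<psi>| < 1\<close>
  (\<open>hexa_zero_free_iff_psi\<close>). The maximum of \<open>|\<psi>|\<close> over the closed bidisc is attained, and \<open>\<psi>\<close>
  vanishes on its boundary; hence the condition describes the hexablock, in each of the three forms
  that mention \<open>\<psi>\<close>.

  On the other hand the polynomial is \<open>det (I - A X)\<close> when the point is \<open>\<pi>(A)\<close>, which relates the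
  condition to \<open>\<mu>(A) < 1\<close>. By compactness the condition is open, so it survives a small dilation of
  \<open>A\<close>; this is what makes the infimum in \<open>\<mu>\<close> strictly larger than 1 (\<open>mu_hexa_less_1_iff\<close>).
  A point with \<open>a \<noteq> 0\<close> is \<open>\<pi>(A)\<close> for some \<open>A\<close>, since the entry \<open>A $ 1 $ 2\<close> can be solved from the
  determinant; if \<open>a = 0\<close> this needs \<open>x3 = x1 x2\<close>. So \<open>hexablock_mu\<close> is the hexablock without part
  of the slice \<open>a = 0\<close>, and openness of the condition puts the points with \<open>a \<noteq> 0\<close> in its interior.
\<close>

section \<open>Upper triangular contractions\<close>

definition contraction_params :: "(complex \<times> complex \<times> complex) set" where
  "contraction_params = {(z1, z2, w). cmod z1 \<le> 1 \<and> cmod z2 \<le> 1 \<and>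
     (cmod w)\<^sup>2 \<le> (1 - (cmod z1)\<^sup>2) * (1 - (cmod z2)\<^sup>2)}"

definition upper_matrix :: "complex \<Rightarrow> complex \<Rightarrow> complex \<Rightarrow> complex^2^2" where
  "upper_matrix z1 z2 w = vector [vector [z1, w], vector [0, z2]]"

lemma upper_matrix_nth [simp]:
  "upper_matrix z1 z2 w $ 1 $ 1 = z1" "upper_matrix z1 z2 w $ 1 $ 2 = w"
  "upper_matrix z1 z2 w $ 2 $ 1 = 0" "upper_matrix z1 z2 w $ 2 $ 2 = z2"
  by (simp_all add: upper_matrix_def)

lemma upper_matrix_eq:
  assumes "X \<in> upper_triangular2"
  shows "X = upper_matrix (X $ 1 $ 1) (X $ 2 $ 2) (X $ 1 $ 2)"
  using assms by (simp add: vec_eq_iff forall_2 upper_triangular2_def)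

lemma norm2_sq:
  fixes v :: "complex^2"
  shows "(norm v)\<^sup>2 = (cmod (v $ 1))\<^sup>2 + (cmod (v $ 2))\<^sup>2"
  by (simp add: norm_vec_def L2_set_def sum_2 real_sqrt_pow2)

lemma bounded_linear_matrix_vector:
  fixes A :: "complex^2^2"
  shows "bounded_linear (\<lambda>v. A *v v)"
  by (rule linear_conv_bounded_linear[THEN iffD1])
     (simp add: linear_iff matrix_vector_right_distrib vec_eq_iff forall_2
       matrix_vector_mult_def sum_2 scaleR_right_distrib algebra_simps)

lemma norm_matrix_vector_le: "norm (A *v v) \<le> opnorm A * norm v"
  unfolding opnorm_def by (rule onorm[OF bounded_linear_matrix_vector])

lemma opnorm_le_iff:
  assumes "0 \<le> c"
  shows "opnorm A \<le> c \<longleftrightarrow> (\<forall>v. (norm (A *v v))\<^sup>2 \<le> c\<^sup>2 * (norm v)\<^sup>2)"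
proof -
  have "opnorm A \<le> c \<longleftrightarrow> (\<forall>v. norm (A *v v) \<le> c * norm v)"
    using onorm_bound[OF assms, of "\<lambda>v. A *v v"] norm_matrix_vector_le[of A]
    unfolding opnorm_def by (meson mult_right_mono norm_ge_zero order_trans)
  then show ?thesis
    using assms by (simp add: power_mult_distrib[symmetric] abs_le_square_iff[symmetric])
qed

lemma opnorm_ge_0: "0 \<le> opnorm A"
  unfolding opnorm_def by (rule onorm_pos_le[OF bounded_linear_matrix_vector])

lemma upper_matrix_mult_norm_sq:
  "(norm (upper_matrix z1 z2 w *v v))\<^sup>2 =
     (cmod (z1 * v $ 1 + w * v $ 2))\<^sup>2 + (cmod (z2 * v $ 2))\<^sup>2"
  by (simp add: norm2_sq matrix_vector_mult_def sum_2)

text \<open>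
  With \<open>\<alpha>\<^sup>2 = 1 - |z1|\<^sup>2\<close> and \<open>\<beta>\<^sup>2 = 1 - |z2|\<^sup>2\<close>, the bound \<open>|w| \<le> \<alpha> \<beta>\<close> lets the Cauchy--Schwarz
  inequality bound the squared modulus of the first coordinate of \<open>X v\<close> by \<open>|v1|\<^sup>2 + \<beta>\<^sup>2 |v2|\<^sup>2\<close>, and \<open>\<beta>\<^sup>2 |v2|\<^sup>2\<close> is what
  the second coordinate leaves over.
\<close>
lemma contraction_params_imp_opnorm_le:
  assumes "(z1, z2, w) \<in> contraction_params"
  shows "opnorm (upper_matrix z1 z2 w) \<le> 1"
proof -
  have p: "(cmod z1)\<^sup>2 \<le> 1" "(cmod z2)\<^sup>2 \<le> 1"
    using assms by (auto simp: contraction_params_def power_le_one)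
  define \<alpha> \<beta> where "\<alpha> = sqrt (1 - (cmod z1)\<^sup>2)" and "\<beta> = sqrt (1 - (cmod z2)\<^sup>2)"
  have ab: "0 \<le> \<alpha>" "0 \<le> \<beta>" "\<alpha>\<^sup>2 = 1 - (cmod z1)\<^sup>2" "\<beta>\<^sup>2 = 1 - (cmod z2)\<^sup>2"
    using p by (auto simp: \<alpha>_def \<beta>_def)
  have "(cmod w)\<^sup>2 \<le> (\<alpha> * \<beta>)\<^sup>2"
    using assms by (simp add: contraction_params_def ab power_mult_distrib)
  then have w: "cmod w \<le> \<alpha> * \<beta>"
    by (rule power2_le_imp_le) (simp add: ab(1,2))
  have "(cmod (z1 * v $ 1 + w * v $ 2))\<^sup>2 + (cmod (z2 * v $ 2))\<^sup>2 \<le> (norm v)\<^sup>2" for v :: "complex^2"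
  proof -
    define p s t where "p = cmod z1" and "s = cmod (v $ 1)" and "t = cmod (v $ 2)"
    have "cmod (z1 * v $ 1 + w * v $ 2) \<le> p * s + cmod w * t"
      unfolding p_def s_def t_def norm_mult[symmetric] by (rule norm_triangle_ineq)
    also have "\<dots> \<le> p * s + \<alpha> * \<beta> * t"
      using mult_right_mono[OF w, of t] by (simp add: t_def)
    finally have "(cmod (z1 * v $ 1 + w * v $ 2))\<^sup>2 \<le> (p * s + \<alpha> * \<beta> * t)\<^sup>2"
      by (rule power_mono) simp
    \<comment> \<open>Cauchy--Schwarz for the unit vector \<open>(p, \<alpha>)\<close> and \<open>(s, \<beta> t)\<close>\<close>
    also have "\<dots> \<le> (p\<^sup>2 + \<alpha>\<^sup>2) * (s\<^sup>2 + \<beta>\<^sup>2 * t\<^sup>2)"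
    proof -
      have "(p\<^sup>2 + \<alpha>\<^sup>2) * (s\<^sup>2 + \<beta>\<^sup>2 * t\<^sup>2) = (p * s + \<alpha> * \<beta> * t)\<^sup>2 + (p * \<beta> * t - \<alpha> * s)\<^sup>2"
        by (simp add: power2_eq_square algebra_simps)
      then show ?thesis by simp
    qed
    also have "\<dots> = s\<^sup>2 + (1 - (cmod z2)\<^sup>2) * t\<^sup>2"
      by (simp add: ab p_def)
    finally show ?thesis
      unfolding norm2_sq norm_mult[of z2] power_mult_distrib s_def t_def by (simp add: left_diff_distrib)
  qed
  then show ?thesis
    by (simp add: opnorm_le_iff upper_matrix_mult_norm_sq)
qed

text \<open>
  Test vectors \<open>(z1\<^sup>* w, t)\<close> with real \<open>t \<ge> 0\<close> make both terms of the first coordinate of \<open>X v\<close> point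
  in the direction of \<open>w\<close>. If \<open>|z1| < 1\<close>, the choice \<open>t = 1 - |z1|\<^sup>2\<close> is sharp; if \<open>|z1| = 1\<close>
  and \<open>w \<noteq> 0\<close>, every \<open>t\<close> with \<open>0 < t < 2 |w|\<^sup>2\<close> violates contractivity, and \<open>t = |w|\<^sup>2\<close> is used.
\<close>
lemma opnorm_le_imp_contraction_params:
  assumes "opnorm (upper_matrix z1 z2 w) \<le> 1"
  shows "(z1, z2, w) \<in> contraction_params"
proof -
  define p q r where "p = cmod z1" and "q = cmod z2" and "r = cmod w"
  have contr: "(cmod (z1 * s + w * t))\<^sup>2 + (q * cmod t)\<^sup>2 \<le> (cmod s)\<^sup>2 + (cmod t)\<^sup>2" for s t
    using assms[unfolded opnorm_le_iff[OF zero_le_one] upper_matrix_mult_norm_sq,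
        rule_format, of "vector [s, t]"]
    by (simp add: norm2_sq norm_mult q_def)
  have p: "p\<^sup>2 \<le> 1" using contr[of 1 0] by (simp add: p_def)
  have "(cmod (z1 * 0 + w * 1))\<^sup>2 + q\<^sup>2 \<le> 1" using contr[of 0 1] by simp
  then have q: "q\<^sup>2 \<le> 1" using zero_le_power2[of "cmod (z1 * 0 + w * 1)"] by linarith
  have test: "(r * (p\<^sup>2 + t))\<^sup>2 + q\<^sup>2 * t\<^sup>2 \<le> p\<^sup>2 * r\<^sup>2 + t\<^sup>2" if "0 \<le> t" for t :: real
  proof -
    have "z1 * (cnj z1 * w) + w * of_real t = w * (z1 * cnj z1 + of_real t)"
      by (simp add: algebra_simps)
    also have "\<dots> = w * of_real (p\<^sup>2 + t)"
      unfolding p_def complex_norm_square[symmetric] of_real_add ..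
    finally have "cmod (z1 * (cnj z1 * w) + w * of_real t) = r * (p\<^sup>2 + t)"
      using that by (simp only: norm_mult norm_of_real r_def) simp
    moreover have "cmod (cnj z1 * w) = p * r" "cmod (of_real t) = t"
      using that by (simp_all add: norm_mult p_def r_def)
    ultimately show ?thesis
      using contr[of "cnj z1 * w" "of_real t"] by (simp only: power_mult_distrib)
  qed
  have "r\<^sup>2 \<le> (1 - p\<^sup>2) * (1 - q\<^sup>2)"
  proof (cases "p\<^sup>2 = 1")
    case True
    have "(r * (1 + r\<^sup>2))\<^sup>2 + q\<^sup>2 * (r\<^sup>2)\<^sup>2 \<le> r\<^sup>2 + (r\<^sup>2)\<^sup>2"
      using test[of "r\<^sup>2"] True by simp
    then have "(r\<^sup>2)\<^sup>2 + r\<^sup>2 * (r\<^sup>2)\<^sup>2 + q\<^sup>2 * (r\<^sup>2)\<^sup>2 \<le> 0"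
      by (simp add: power2_eq_square algebra_simps)
    moreover have "0 \<le> r\<^sup>2 * (r\<^sup>2)\<^sup>2" "0 \<le> q\<^sup>2 * (r\<^sup>2)\<^sup>2" by simp_all
    ultimately have "(r\<^sup>2)\<^sup>2 \<le> 0" by linarith
    then show ?thesis using True by simp
  next
    case False
    with p have "0 < 1 - p\<^sup>2" by simp
    moreover have "(1 - p\<^sup>2) * r\<^sup>2 \<le> (1 - p\<^sup>2) * ((1 - p\<^sup>2) * (1 - q\<^sup>2))"
      using test[of "1 - p\<^sup>2"] p by (simp add: power2_eq_square algebra_simps)
    ultimately show ?thesis by simp
  qed
  then show ?thesis
    using p q by (simp add: contraction_params_def p_def q_def r_def abs_square_le_1)
qed

lemma opnorm_le_1_iff:
  "opnorm (upper_matrix z1 z2 w) \<le> 1 \<longleftrightarrow> (z1, z2, w) \<in> contraction_params"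
  using contraction_params_imp_opnorm_le opnorm_le_imp_contraction_params by blast

section \<open>The zero-free condition\<close>

definition hexa_poly ::
    "complex \<times> complex \<times> complex \<times> complex \<Rightarrow> complex \<times> complex \<times> complex \<Rightarrow> complex" where
  "hexa_poly = (\<lambda>(a, x1, x2, x3) (z1, z2, w). 1 - x1 * z1 - x2 * z2 + x3 * z1 * z2 - a * w)"

definition hexa_zero_free :: "(complex \<times> complex \<times> complex \<times> complex) set" where
  "hexa_zero_free = {p. \<forall>q\<in>contraction_params. hexa_poly p q \<noteq> 0}"

lemma det_mat1_minus_mult:
  "det (mat 1 - A ** upper_matrix z1 z2 w) = hexa_poly (hexa_pi A) (z1, z2, w)"
  by (simp add: det_2 matrix_matrix_mult_def sum_2 mat_def hexa_poly_def hexa_pi_def algebra_simps)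

text \<open>
  Taking \<open>w = 0\<close> gives membership in the tetrablock. If \<open>|\<psi>| \<ge> 1\<close> at \<open>(z1, z2)\<close>, then \<open>w = d / a\<close>, with
  \<open>d\<close> the denominator of \<open>\<psi>\<close>, is small enough to be an admissible zero; conversely a zero has
  \<open>d = a w\<close>.
\<close>
lemma hexa_zero_free_iff_psi:
  "(a, x1, x2, x3) \<in> hexa_zero_free \<longleftrightarrow> (x1, x2, x3) \<in> tetrablock \<and>
     (\<forall>z1\<in>cball 0 1. \<forall>z2\<in>cball 0 1. cmod (hexa_psi z1 z2 (a, x1, x2, x3)) < 1)"
    (is "?L \<longleftrightarrow> ?E \<and> ?P")
proof
  assume L: ?L
  have nz: "hexa_poly (a, x1, x2, x3) (z1, z2, w) \<noteq> 0"
    if "cmod z1 \<le> 1" "cmod z2 \<le> 1" "(cmod w)\<^sup>2 \<le> (1 - (cmod z1)\<^sup>2) * (1 - (cmod z2)\<^sup>2)" for z1 z2 w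
    using L that by (auto simp: hexa_zero_free_def contraction_params_def)
  have pos: "0 \<le> (1 - (cmod z1)\<^sup>2) * (1 - (cmod z2)\<^sup>2)" if "cmod z1 \<le> 1" "cmod z2 \<le> 1" for z1 z2
    using that by (simp add: power_le_one)
  have E: "1 - x1 * z1 - x2 * z2 + x3 * z1 * z2 \<noteq> 0" if "cmod z1 \<le> 1" "cmod z2 \<le> 1" for z1 z2
    using nz[of z1 z2 0] pos that by (simp add: hexa_poly_def)
  have "cmod (hexa_psi z1 z2 (a, x1, x2, x3)) < 1" if z: "cmod z1 \<le> 1" "cmod z2 \<le> 1" for z1 z2
  proof (rule ccontr)
    define d where "d = 1 - x1 * z1 - x2 * z2 + x3 * z1 * z2"
    define \<rho> where "\<rho> = sqrt ((1 - (cmod z1)\<^sup>2) * (1 - (cmod z2)\<^sup>2))"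
    have \<rho>: "0 \<le> \<rho>" "\<rho>\<^sup>2 = (1 - (cmod z1)\<^sup>2) * (1 - (cmod z2)\<^sup>2)"
      using pos[OF z] by (auto simp: \<rho>_def)
    have d: "d \<noteq> 0" using E[OF z] by (simp add: d_def)
    assume "\<not> cmod (hexa_psi z1 z2 (a, x1, x2, x3)) < 1"
    then have "cmod d \<le> cmod a * \<rho>"
      using d \<rho> by (simp add: hexa_psi_def d_def[symmetric] \<rho>_def[symmetric]
          norm_divide norm_mult divide_simps not_less split: if_splits)
    moreover from this have a: "a \<noteq> 0" using d by auto
    ultimately have "cmod (d / a) \<le> \<rho>" by (simp add: norm_divide divide_simps mult.commute)
    then have "(cmod (d / a))\<^sup>2 \<le> (1 - (cmod z1)\<^sup>2) * (1 - (cmod z2)\<^sup>2)"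
      unfolding \<rho>(2)[symmetric] by (simp add: power_mono)
    from nz[OF z this] show False
      using a by (simp add: hexa_poly_def d_def)
  qed
  with E show "?E \<and> ?P" by (auto simp: tetrablock_def)
next
  assume R: "?E \<and> ?P"
  show ?L
  proof (clarsimp simp: hexa_zero_free_def contraction_params_def)
    fix z1 z2 w
    assume z: "cmod z1 \<le> 1" "cmod z2 \<le> 1"
      and w: "(cmod w)\<^sup>2 \<le> (1 - (cmod z1)\<^sup>2) * (1 - (cmod z2)\<^sup>2)"
      and 0: "hexa_poly (a, x1, x2, x3) (z1, z2, w) = 0"
    define d where "d = 1 - x1 * z1 - x2 * z2 + x3 * z1 * z2"
    define \<rho> where "\<rho> = sqrt ((1 - (cmod z1)\<^sup>2) * (1 - (cmod z2)\<^sup>2))"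
    have "cmod w \<le> \<rho>" using w by (simp add: \<rho>_def real_le_rsqrt)
    have \<rho>: "0 \<le> \<rho>" using z by (simp add: \<rho>_def power_le_one)
    have d: "d \<noteq> 0" "d = a * w" using R z 0 by (auto simp: d_def tetrablock_def hexa_poly_def)
    have "cmod (hexa_psi z1 z2 (a, x1, x2, x3)) < 1" using R z by simp
    then have "cmod a * \<rho> < cmod d"
      using d \<rho> unfolding hexa_psi_def
      by (simp add: d_def[symmetric] \<rho>_def[symmetric] norm_divide norm_mult divide_simps)
    also have "\<dots> \<le> cmod a * \<rho>" using d \<open>cmod w \<le> \<rho>\<close> by (simp add: norm_mult mult_left_mono)
    finally show False by simp
  qed
qed

lemma hexa_zero_free_iff_K_star:
  "(a, x1, x2, x3) \<in> hexa_zero_free \<longleftrightarrow>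
     (x1, x2, x3) \<in> tetrablock \<and> cmod a * K_star (x1, x2, x3) < 1"
proof (cases "(x1, x2, x3) \<in> tetrablock")
  case True
  have scale: "cmod (hexa_psi z1 z2 (a, x1, x2, x3)) = cmod a * cmod (hexa_psi z1 z2 (1, x1, x2, x3))"
    for z1 z2 by (simp add: hexa_psi_def norm_mult norm_divide)
  obtain w1 w2 where w: "w1 \<in> cball 0 1" "w2 \<in> cball 0 1"
      "K_star (x1, x2, x3) = cmod (hexa_psi w1 w2 (1, x1, x2, x3))"
    and le: "\<And>z1 z2. z1 \<in> cball 0 1 \<Longrightarrow> z2 \<in> cball 0 1 \<Longrightarrow>
      cmod (hexa_psi z1 z2 (1, x1, x2, x3)) \<le> K_star (x1, x2, x3)"
    using K_star_attained[OF True] by blast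
  have "(\<forall>z1\<in>cball 0 1. \<forall>z2\<in>cball 0 1. cmod a * cmod (hexa_psi z1 z2 (1, x1, x2, x3)) < 1)
      \<longleftrightarrow> cmod a * K_star (x1, x2, x3) < 1"
  proof
    assume "cmod a * K_star (x1, x2, x3) < 1"
    then show "\<forall>z1\<in>cball 0 1. \<forall>z2\<in>cball 0 1. cmod a * cmod (hexa_psi z1 z2 (1, x1, x2, x3)) < 1"
      by (intro ballI order_le_less_trans[OF mult_left_mono[OF le]]) auto
  next
    assume "\<forall>z1\<in>cball 0 1. \<forall>z2\<in>cball 0 1. cmod a * cmod (hexa_psi z1 z2 (1, x1, x2, x3)) < 1"
    with w show "cmod a * K_star (x1, x2, x3) < 1" by simp
  qed
  with True show ?thesis by (simp only: hexa_zero_free_iff_psi scale simp_thms)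
qed (simp add: hexa_zero_free_iff_psi)

lemma hexa_psi_boundary:
  assumes "z1 \<in> cball 0 1" "z2 \<in> cball 0 1" "z1 \<notin> ball 0 1 \<or> z2 \<notin> ball 0 1"
  shows "hexa_psi z1 z2 p = 0"
  using assms by (cases p) (auto simp: hexa_psi_def)

lemma hexa_zero_free_iff_open_discs:
  "(a, x1, x2, x3) \<in> hexa_zero_free \<longleftrightarrow> (x1, x2, x3) \<in> tetrablock \<and>
     (\<forall>z1\<in>ball 0 1. \<forall>z2\<in>ball 0 1. cmod (hexa_psi z1 z2 (a, x1, x2, x3)) < 1)"
proof -
  have "cmod (hexa_psi z1 z2 (a, x1, x2, x3)) < 1"
    if "\<forall>z1\<in>ball 0 1. \<forall>z2\<in>ball 0 1. cmod (hexa_psi z1 z2 (a, x1, x2, x3)) < 1"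
      "z1 \<in> cball 0 1" "z2 \<in> cball 0 1" for z1 z2
    using that hexa_psi_boundary[of z1 z2 "(a, x1, x2, x3)"]
    by (cases "z1 \<in> ball 0 1 \<and> z2 \<in> ball 0 1") auto
  then show ?thesis
    unfolding hexa_zero_free_iff_psi using ball_subset_cball by blast
qed

text \<open>
  A supremum of values below 1 over the open bidisc could equal 1; it does not, because the maximum
  over the closed bidisc is itself below 1.
\<close>
lemma hexablock_eq_zero_free: "hexablock = hexa_zero_free"
proof -
  have "(a, x1, x2, x3) \<in> hexablock \<longleftrightarrow> (a, x1, x2, x3) \<in> hexa_zero_free" for a x1 x2 x3
  proof (cases "(x1, x2, x3) \<in> tetrablock")
    case True
    let ?f = "\<lambda>(z1, z2). cmod (hexa_psi z1 z2 (a, x1, x2, x3))"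
    let ?B = "ball 0 1 \<times> ball 0 1 :: (complex \<times> complex) set"
    have bdd: "bdd_above (?f ` ?B)" by (rule hexa_psi_bdd_above[OF True])
    have "(SUP q\<in>?B. ?f q) < 1 \<longleftrightarrow> (\<forall>z1\<in>ball 0 1. \<forall>z2\<in>ball 0 1. ?f (z1, z2) < 1)"
    proof
      assume "(SUP q\<in>?B. ?f q) < 1"
      then show "\<forall>z1\<in>ball 0 1. \<forall>z2\<in>ball 0 1. ?f (z1, z2) < 1"
        by (intro ballI order_le_less_trans[OF cSUP_upper[OF _ bdd]]) auto
    next
      assume *: "\<forall>z1\<in>ball 0 1. \<forall>z2\<in>ball 0 1. ?f (z1, z2) < 1"
      obtain w1 w2 where w: "w1 \<in> cball 0 1" "w2 \<in> cball 0 1"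
        and le: "\<And>z1 z2. z1 \<in> cball 0 1 \<Longrightarrow> z2 \<in> cball 0 1 \<Longrightarrow> ?f (z1, z2) \<le> ?f (w1, w2)"
        using hexa_psi_attains_max[OF True, of a] by auto
      have "?f (w1, w2) < 1"
        using * w True hexa_zero_free_iff_open_discs[of a x1 x2 x3] hexa_zero_free_iff_psi[of a x1 x2 x3]
        by auto
      moreover have "(SUP q\<in>?B. ?f q) \<le> ?f (w1, w2)"
        using le by (intro cSUP_least) (auto simp: less_imp_le)
      ultimately show "(SUP q\<in>?B. ?f q) < 1" by simp
    qed
    then show ?thesis using True by (simp add: hexablock_def hexa_zero_free_iff_open_discs)
  qed (simp add: hexablock_def hexa_zero_free_iff_psi)
  then show ?thesis by auto
qed

lemma compact_contraction_params: "compact contraction_params"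
proof -
  have "contraction_params = {q. cmod (fst q) \<le> 1} \<inter> {q. cmod (fst (snd q)) \<le> 1} \<inter>
      {q. (cmod (snd (snd q)))\<^sup>2 \<le> (1 - (cmod (fst q))\<^sup>2) * (1 - (cmod (fst (snd q)))\<^sup>2)}"
    by (auto simp: contraction_params_def)
  moreover have "closed \<dots>"
    by (intro closed_Int closed_Collect_le continuous_intros)
  ultimately have "closed contraction_params" by simp
  moreover have "contraction_params \<subseteq> cball 0 1 \<times> cball 0 1 \<times> cball 0 1"
  proof (clarsimp simp: contraction_params_def)
    fix z1 z2 w
    assume "cmod z1 \<le> 1" "cmod z2 \<le> 1"
      "(cmod w)\<^sup>2 \<le> (1 - (cmod z1)\<^sup>2) * (1 - (cmod z2)\<^sup>2)"
    moreover from this have "(1 - (cmod z1)\<^sup>2) * (1 - (cmod z2)\<^sup>2) \<le> 1"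
      by (intro mult_le_one) (auto simp: power_le_one)
    ultimately have "(cmod w)\<^sup>2 \<le> 1" by linarith
    then show "cmod w \<le> 1" by (simp add: abs_square_le_1)
  qed
  ultimately show ?thesis
    by (metis bounded_subset bounded_Times bounded_cball compact_eq_bounded_closed)
qed

text \<open>
  The complement is the projection, along a compact set, of the closed zero set of the polynomial.
\<close>
lemma open_hexa_zero_free: "open hexa_zero_free"
proof -
  let ?Z = "{q. hexa_poly (snd q) (fst q) = 0}"
  have "closed ?Z"
    unfolding hexa_poly_def case_prod_beta by (intro closed_Collect_eq continuous_intros)
  then have clo: "closed {p. \<exists>q. q \<in> contraction_params \<and> (q, p) \<in> ?Z}"
    by (rule closed_compact_projection[OF compact_contraction_params])
  have eq: "hexa_zero_free = - {p. \<exists>q. q \<in> contraction_params \<and> (q, p) \<in> ?Z}"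
    by (auto simp: hexa_zero_free_def)
  show ?thesis unfolding eq by (rule open_Compl[OF clo])
qed

section \<open>The structured singular value\<close>

text \<open>
  A fixed vector of \<open>A X\<close> is an obstruction to \<open>A X\<close> being a strict contraction. This keeps the
  infimum in the definition of \<open>\<mu>\<close> away from 0, and shows that \<open>\<mu>(A) < 1\<close> whenever \<open>A\<close> is a strict
  contraction.
\<close>
lemma singular_imp_opnorm_mult_ge_1:
  assumes "det (mat 1 - A ** X) = 0"
  shows "1 \<le> opnorm A * opnorm X"
proof -
  have "\<not> invertible (mat 1 - A ** X)" using assms by (simp add: invertible_det_nz)
  then obtain v where v: "(mat 1 - A ** X) *v v = 0" "v \<noteq> 0"
    by (metis invertible_left_inverse matrix_left_invertible_ker)
  then have "v = A *v (X *v v)"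
    by (simp add: matrix_vector_mult_diff_rdistrib matrix_vector_mul_assoc)
  then have "norm v \<le> opnorm A * norm (X *v v)" using norm_matrix_vector_le by metis
  also have "\<dots> \<le> opnorm A * (opnorm X * norm v)"
    by (intro mult_left_mono norm_matrix_vector_le opnorm_ge_0)
  finally show ?thesis using v(2) by simp
qed

lemma hexa_zero_free_iff_nonsingular:
  "hexa_pi A \<in> hexa_zero_free \<longleftrightarrow>
     (\<forall>X\<in>upper_triangular2. opnorm X \<le> 1 \<longrightarrow> det (mat 1 - A ** X) \<noteq> 0)"
proof
  assume L: "hexa_pi A \<in> hexa_zero_free"
  show "\<forall>X\<in>upper_triangular2. opnorm X \<le> 1 \<longrightarrow> det (mat 1 - A ** X) \<noteq> 0"
  proof (intro ballI impI)
    fix X :: "complex^2^2"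
    assume "X \<in> upper_triangular2" "opnorm X \<le> 1"
    then obtain z1 z2 w where X: "X = upper_matrix z1 z2 w" "opnorm (upper_matrix z1 z2 w) \<le> 1"
      using upper_matrix_eq by metis
    then show "det (mat 1 - A ** X) \<noteq> 0"
      using L by (simp add: opnorm_le_1_iff det_mat1_minus_mult hexa_zero_free_def)
  qed
next
  assume R: "\<forall>X\<in>upper_triangular2. opnorm X \<le> 1 \<longrightarrow> det (mat 1 - A ** X) \<noteq> 0"
  have "upper_matrix z1 z2 w \<in> upper_triangular2" for z1 z2 w
    by (simp add: upper_triangular2_def)
  with R show "hexa_pi A \<in> hexa_zero_free"
    by (auto simp: hexa_zero_free_def opnorm_le_1_iff[symmetric] det_mat1_minus_mult[symmetric])
qed

lemma matrix_scaleR_cancel: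
  fixes A X :: "complex^2^2"
  assumes "t \<noteq> 0"
  shows "(t *\<^sub>R A) ** ((1 / t) *\<^sub>R X) = A ** X"
  using assms by (simp add: vec_eq_iff forall_2 matrix_matrix_mult_def sum_2)

lemma opnorm_scaleR: "opnorm (t *\<^sub>R A) = \<bar>t\<bar> * opnorm A"
proof -
  have "(t *\<^sub>R A) *v v = t *\<^sub>R (A *v v)" for v
    by (simp add: vec_eq_iff forall_2 matrix_vector_mult_def sum_2 scaleR_right_distrib)
  then show ?thesis
    by (simp add: opnorm_def onorm_scaleR bounded_linear_matrix_vector)
qed

text \<open>
  The set of zero-free points is open and \<open>t \<mapsto> \<pi>(t A)\<close> is continuous at 1. The factor \<open>t > 1\<close> will
  separate the norms of all singularising matrices from 1 at once, so that their infimum exceeds 1.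
\<close>
lemma hexa_zero_free_dilate:
  assumes "hexa_pi A \<in> hexa_zero_free"
  obtains t where "1 < t" "hexa_pi (t *\<^sub>R A) \<in> hexa_zero_free"
proof -
  let ?g = "\<lambda>t::real. hexa_pi (t *\<^sub>R A)"
  have "continuous_on UNIV ?g"
    unfolding hexa_pi_def det_2 by (simp, intro continuous_intros)
  then have "open (?g -` hexa_zero_free)"
    using open_hexa_zero_free by (rule open_vimage[rotated])
  moreover have "1 \<in> ?g -` hexa_zero_free" using assms by simp
  ultimately obtain e where "e > 0" "cball 1 e \<subseteq> ?g -` hexa_zero_free"
    by (meson open_contains_cball)
  moreover from \<open>e > 0\<close> have "1 + e \<in> cball 1 e" by (simp add: dist_real_def)
  ultimately have "hexa_pi ((1 + e) *\<^sub>R A) \<in> hexa_zero_free" by blast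
  with \<open>e > 0\<close> show ?thesis using that[of "1 + e"] by simp
qed

text \<open>
  \<open>\<mu>(A) < 1\<close> says that the infimum exceeds 1. If \<open>t A\<close> with \<open>t > 1\<close> is still zero-free, then a
  singularising \<open>X\<close> for \<open>A\<close> with norm at most \<open>t\<close> would give the singularising contraction \<open>X / t\<close>
  for \<open>t A\<close>; so the infimum is at least \<open>t\<close>.
\<close>
lemma mu_hexa_less_1_iff: "mu_hexa A < 1 \<longleftrightarrow> hexa_pi A \<in> hexa_zero_free"
proof (cases "\<forall>X\<in>upper_triangular2. det (mat 1 - A ** X) \<noteq> 0")
  case True
  then show ?thesis by (simp add: mu_hexa_def hexa_zero_free_iff_nonsingular)
next
  case False
  define S where "S = {opnorm X | X. X \<in> upper_triangular2 \<and> det (mat 1 - A ** X) = 0}"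
  have mu: "mu_hexa A = 1 / Inf S" unfolding mu_hexa_def S_def using False by (simp only: if_False)
  obtain X0 where X0: "X0 \<in> upper_triangular2" "det (mat 1 - A ** X0) = 0" using False by auto
  then have ne: "S \<noteq> {}" by (auto simp: S_def)
  have ge: "1 \<le> opnorm A * s" if "s \<in> S" for s
    using that singular_imp_opnorm_mult_ge_1 by (auto simp: S_def)
  have A: "0 < opnorm A"
    using singular_imp_opnorm_mult_ge_1[OF X0(2)] opnorm_ge_0[of A] by (cases "opnorm A = 0") auto
  have lower: "1 / opnorm A \<le> Inf S"
    using ge A by (intro cInf_greatest[OF ne]) (simp add: divide_simps mult.commute)
  then have pos: "0 < Inf S" using A by (smt (verit) divide_pos_pos)
  have "1 < Inf S \<longleftrightarrow> hexa_pi A \<in> hexa_zero_free"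
  proof
    assume less: "1 < Inf S"
    have "bdd_below S" using opnorm_ge_0 by (intro bdd_belowI[of _ 0]) (auto simp: S_def)
    then have "1 < s" if "s \<in> S" for s using cInf_lower[OF that] less by linarith
    then show "hexa_pi A \<in> hexa_zero_free"
      unfolding hexa_zero_free_iff_nonsingular S_def by fastforce
  next
    assume "hexa_pi A \<in> hexa_zero_free"
    then obtain t where t: "1 < t" "hexa_pi (t *\<^sub>R A) \<in> hexa_zero_free"
      by (rule hexa_zero_free_dilate)
    have "t \<le> opnorm X" if X: "X \<in> upper_triangular2" "det (mat 1 - A ** X) = 0" for X
    proof (rule ccontr)
      assume "\<not> t \<le> opnorm X"
      then have "opnorm ((1 / t) *\<^sub>R X) \<le> 1" using t by (simp only: opnorm_scaleR) simp
      moreover have "(1 / t) *\<^sub>R X \<in> upper_triangular2" using X by (simp add: upper_triangular2_def)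
      ultimately have "det (mat 1 - (t *\<^sub>R A) ** ((1 / t) *\<^sub>R X)) \<noteq> 0"
        using t(2) unfolding hexa_zero_free_iff_nonsingular by blast
      with X t show False by (subst (asm) matrix_scaleR_cancel) auto
    qed
    then have "t \<le> Inf S" by (intro cInf_greatest[OF ne]) (auto simp: S_def)
    with t show "1 < Inf S" by simp
  qed
  then show ?thesis using pos by (simp add: mu)
qed

section \<open>The three domains\<close>

lemma hexablock_mu_iff:
  "(a, x1, x2, x3) \<in> hexablock_mu \<longleftrightarrow>
     (a, x1, x2, x3) \<in> hexa_zero_free \<and> (a = 0 \<longrightarrow> x3 = x1 * x2)"
proof
  assume "(a, x1, x2, x3) \<in> hexablock_mu"
  then show "(a, x1, x2, x3) \<in> hexa_zero_free \<and> (a = 0 \<longrightarrow> x3 = x1 * x2)"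
    by (auto simp: hexablock_mu_def mu_hexa_less_1_iff) (auto simp: hexa_pi_def det_2)
next
  assume R: "(a, x1, x2, x3) \<in> hexa_zero_free \<and> (a = 0 \<longrightarrow> x3 = x1 * x2)"
  \<comment> \<open>the upper right entry solves \<open>det A = x3\<close>; division by \<open>a = 0\<close> makes it \<open>0\<close>, and then \<open>det A = x1 * x2 = x3\<close>\<close>
  define A :: "complex^2^2" where
    "A = vector [vector [x1, (x1 * x2 - x3) / a], vector [a, x2]]"
  have "hexa_pi A = (a, x1, x2, x3)"
    using R by (cases "a = 0") (auto simp: A_def hexa_pi_def det_2)
  with R show "(a, x1, x2, x3) \<in> hexablock_mu"
    unfolding hexablock_mu_def using mu_hexa_less_1_iff[of A] by (metis (mono_tags, lifting) mem_Collect_eq)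
qed

lemma tetrablock_imp_zero_free:
  "(x1, x2, x3) \<in> tetrablock \<Longrightarrow> (0, x1, x2, x3) \<in> hexa_zero_free"
  by (simp add: hexa_zero_free_iff_psi hexa_psi_def)

lemma hexablock_mu_interior:
  assumes "(a, x1, x2, x3) \<in> hexa_zero_free" "a \<noteq> 0"
  shows "(a, x1, x2, x3) \<in> interior hexablock_mu"
proof (rule interiorI)
  show "open (hexa_zero_free \<inter> {p. fst p \<noteq> 0})"
    by (intro open_Int open_hexa_zero_free open_Collect_neq continuous_intros)
  show "hexa_zero_free \<inter> {p. fst p \<noteq> 0} \<subseteq> hexablock_mu"
    by (auto simp: hexablock_mu_iff)
qed (use assms in auto)

lemma hexablock_norm_subset_mu: "hexablock_norm \<subseteq> hexablock_mu"
proof -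
  have "hexa_pi A \<in> hexa_zero_free" if "opnorm A < 1" for A
    unfolding hexa_zero_free_iff_nonsingular
  proof (intro ballI impI notI)
    fix X assume "opnorm X \<le> 1" "det (mat 1 - A ** X) = 0"
    then have "1 \<le> opnorm A * opnorm X" "opnorm A * opnorm X \<le> opnorm A"
      by (auto intro: singular_imp_opnorm_mult_ge_1 mult_left_le opnorm_ge_0)
    with that show False by simp
  qed
  then show ?thesis by (auto simp: hexablock_norm_def hexablock_mu_def mu_hexa_less_1_iff)
qed

theorem theorem5p1:
  fixes a x1 x2 x3 :: complex
  shows "((a, x1, x2, x3) \<in> hexablock \<longleftrightarrow>
            (x1, x2, x3) \<in> tetrablock \<and> cmod a * K_star (x1, x2, x3) < 1)
       \<and> ((a, x1, x2, x3) \<in> hexablock \<longleftrightarrow>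
            (x1, x2, x3) \<in> tetrablock \<and>
            (\<forall>z1\<in>ball 0 1. \<forall>z2\<in>ball 0 1. cmod (hexa_psi z1 z2 (a, x1, x2, x3)) < 1))
       \<and> ((a, x1, x2, x3) \<in> hexablock \<longleftrightarrow>
            (a, x1, x2, x3) \<in> hexablock_mu \<or> (a, x1, x2, x3) \<in> {0} \<times> tetrablock)
       \<and> hexablock = hexablock_mu \<union> ({0} \<times> tetrablock)
       \<and> hexablock_mu \<union> ({0} \<times> tetrablock) = interior hexablock_mu \<union> ({0} \<times> tetrablock)
       \<and> hexablock_norm \<subseteq> hexablock_mu
       \<and> hexablock_mu \<subseteq> hexablock"
proof -
  have mu_sub: "hexablock_mu \<subseteq> hexablock"
    by (auto simp: hexablock_eq_zero_free hexablock_mu_iff)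
  have zero_sub: "{0} \<times> tetrablock \<subseteq> hexablock"
    by (auto simp: hexablock_eq_zero_free tetrablock_imp_zero_free)
  have sub: "hexablock \<subseteq> interior hexablock_mu \<union> ({0} \<times> tetrablock)"
  proof
    fix p assume "p \<in> hexablock"
    moreover obtain b y1 y2 y3 where p: "p = (b, y1, y2, y3)" by (cases p)
    ultimately have "(b, y1, y2, y3) \<in> hexa_zero_free" by (simp add: hexablock_eq_zero_free)
    then show "p \<in> interior hexablock_mu \<union> ({0} \<times> tetrablock)"
      using hexablock_mu_interior[of b y1 y2 y3]
      by (cases "b = 0") (auto simp: p hexa_zero_free_iff_psi)
  qed
  have union: "hexablock = hexablock_mu \<union> ({0} \<times> tetrablock)"
    and union_interior:
      "hexablock_mu \<union> ({0} \<times> tetrablock) = interior hexablock_mu \<union> ({0} \<times> tetrablock)"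
    using mu_sub zero_sub sub interior_subset[of hexablock_mu] by blast+
  have "(a, x1, x2, x3) \<in> hexablock \<longleftrightarrow>
      (a, x1, x2, x3) \<in> hexablock_mu \<or> (a, x1, x2, x3) \<in> {0} \<times> tetrablock"
    using union by blast
  moreover have "(a, x1, x2, x3) \<in> hexablock \<longleftrightarrow>
      (x1, x2, x3) \<in> tetrablock \<and> cmod a * K_star (x1, x2, x3) < 1"
    by (simp only: hexablock_eq_zero_free hexa_zero_free_iff_K_star)
  moreover have "(a, x1, x2, x3) \<in> hexablock \<longleftrightarrow> (x1, x2, x3) \<in> tetrablock \<and>
      (\<forall>z1\<in>ball 0 1. \<forall>z2\<in>ball 0 1. cmod (hexa_psi z1 z2 (a, x1, x2, x3)) < 1)"
    by (simp only: hexablock_eq_zero_free hexa_zero_free_iff_open_discs)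
  ultimately show ?thesis
    using union union_interior hexablock_norm_subset_mu mu_sub by (intro conjI)
qed

end
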